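(* Let $B$ be a skew brace and $A$ a sub skew brace of $B$ such that both indices $|B:A|_+$ and $|B:A|_\circ$ are finite. Then there exists a strong left ideal $L$ of $B$ of finite index contained in $A$.
   Context: A skew brace is a triple $(B,+,\circ)$ where $(B,+)$ and $(B,\circ)$ are (not necessarily abelian) groups with $a\circ(b+c)=a\circ b-a+a\circ c$ for all $a,b,c\in B$; $-a$ is the inverse of $a$ in $(B,+)$ and $\circ$ takes precedence over $+$. For $a,b\in B$ put $\lambda_a(b)=-a+a\circ b$; then $\lambda:(B,\circ)\to\operatorname{Aut}(B,+)$, $a\mapsto\lambda_a$, is a group homomorphism. A sub skew brace of $B$ is a subgroup $A$ of $(B,+)$ with $\lambda_a(A)=A$ for all $a\in A$ (equivalently, $A$ is a subgroup of both $(B,+)$ and $(B,\circ)$). $|B:A|_+$ and $|B:A|_\circ$ denote the index of $(A,+)$ in $(B,+)$ and of $(A,\circ)$ in $(B,\circ)$. A left ideal is a subgroup $L$ of $(B,+)$ with $\lambda_b(L)=L$ for all $b\in B$; a strong left ideal is a left ideal that is normal in $(B,+)$. For a left ideal $L$ one has $a+L=a\circ L$ for all $a\in B$, so its additive and multiplicative indices in $B$ coincide and "finite index" is unambiguous. *)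

theory Defs
  imports "HOL-Algebra.Algebra"
begin

text \<open>
  The ring record carries the two operations of a skew brace on one carrier: \<open>\<oplus>\<close> is the
  (not necessarily commutative) addition and \<open>\<otimes>\<close> is the circle operation.  Only the record
  type is used, no ring axiom.  The group \<open>(B,+)\<close> is \<open>add_monoid B\<close>, and \<open>(B,\<circ>)\<close> is \<open>B\<close> itself.
\<close>

locale skew_brace =
  fixes B (structure)
  assumes additive_group: "group (add_monoid B)"
    and circle_group: "group B"
    and brace_distrib:
      "\<lbrakk>a \<in> carrier B; b \<in> carrier B; c \<in> carrier B\<rbrakk>
        \<Longrightarrow> a \<otimes> (b \<oplus> c) = (a \<otimes> b \<ominus> a) \<oplus> a \<otimes> c"

definition lambda_map :: "('a, 'm) ring_scheme \<Rightarrow> 'a \<Rightarrow> 'a \<Rightarrow> 'a"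
  where "lambda_map B a b = (\<ominus>\<^bsub>B\<^esub> a) \<oplus>\<^bsub>B\<^esub> (a \<otimes>\<^bsub>B\<^esub> b)"

definition sub_skew_brace :: "'a set \<Rightarrow> ('a, 'm) ring_scheme \<Rightarrow> bool"
  where "sub_skew_brace A B \<longleftrightarrow>
    subgroup A (add_monoid B) \<and> (\<forall>a\<in>A. lambda_map B a ` A = A)"

definition left_ideal :: "'a set \<Rightarrow> ('a, 'm) ring_scheme \<Rightarrow> bool"
  where "left_ideal L B \<longleftrightarrow>
    subgroup L (add_monoid B) \<and> (\<forall>b\<in>carrier B. lambda_map B b ` L = L)"

definition strong_left_ideal :: "'a set \<Rightarrow> ('a, 'm) ring_scheme \<Rightarrow> bool"
  where "strong_left_ideal L B \<longleftrightarrow> left_ideal L B \<and> L \<lhd> add_monoid B"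

text \<open>
  Finiteness of the set of cosets is used because \<^term>\<open>card\<close> sends infinite sets to \<open>0\<close>.
  Right cosets are as good as left ones, since inversion exchanges the two.
\<close>

definition finite_index :: "'a set \<Rightarrow> ('a, 'm) monoid_scheme \<Rightarrow> bool"
  where "finite_index H G \<longleftrightarrow> finite (rcosets\<^bsub>G\<^esub> H)"

end

theory Submission
  imports Defs
begin

text \<open>
  The maps \<open>x \<mapsto> c + \<lambda>\<^sub>b(x) - c\<close> are automorphisms of \<open>(B,+)\<close>; they form the group generated by
  all \<open>\<lambda>\<^sub>b\<close> and all inner automorphisms, because \<open>\<lambda>\<^sub>b\<close> carries conjugation by \<open>c\<close> to conjugation
  by \<open>\<lambda>\<^sub>b(c)\<close>.  A subgroup of \<open>(B,+)\<close> is a strong left ideal exactly when it is invariant under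
  this group, so the largest strong left ideal inside \<open>A\<close> is the core
  \<open>L = {x. c + \<lambda>\<^sub>b(x) - c \<in> A for all b, c}\<close>, the intersection of the preimages of \<open>A\<close> under the group.

  The point is that finitely many preimages suffice.  If \<open>b\<close> is replaced by \<open>a \<circ> b\<close> with \<open>a \<in> A\<close>,
  one may apply \<open>\<lambda>\<^sub>a\<close>, which preserves \<open>A\<close>; this changes \<open>c\<close>, but \<open>c\<close> itself only matters
  modulo \<open>(A,+)\<close>.  So \<open>b\<close> can be restricted to representatives of the cosets of \<open>(A,\<circ>)\<close> and \<open>c\<close> to
  representatives of the cosets of \<open>(A,+)\<close> (lemma \<open>core_iff_representatives\<close>).  Both sets are
  finite, and each preimage has finite additive index, hence so has \<open>L\<close>.  Finally the additive and
  the multiplicative cosets \<open>x + L\<close> and \<open>x \<circ> L\<close> of a left ideal coincide, which gives finite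
  multiplicative index.
\<close>

section \<open>Subgroups of finite index\<close>

lemma (in group) finite_index_representatives:
  assumes H: "subgroup H G" and fin: "finite_index H G"
  obtains R where "finite R" "R \<subseteq> carrier G"
    "\<And>x. x \<in> carrier G \<Longrightarrow> \<exists>h\<in>H. \<exists>r\<in>R. x = h \<otimes> r"
proof
  let ?rep = "\<lambda>C. SOME r. r \<in> carrier G \<and> C = H #> r"
  have rep: "?rep C \<in> carrier G \<and> C = H #> ?rep C" if "C \<in> rcosets H" for C
    using that by (intro someI_ex[of "\<lambda>r. r \<in> carrier G \<and> C = H #> r"]) (auto simp: RCOSETS_def)
  show "finite (?rep ` (rcosets H))"
    using fin by (simp add: finite_index_def)
  show "?rep ` (rcosets H) \<subseteq> carrier G"
    using rep by blast
  show "\<exists>h\<in>H. \<exists>r\<in>?rep ` (rcosets H). x = h \<otimes> r" if x: "x \<in> carrier G" for x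
  proof -
    have C: "H #> x \<in> rcosets H"
      using x H by (simp add: rcosetsI subgroup.subset)
    have "x \<in> H #> x"
      using x H by (rule rcos_self)
    then have "x \<in> H #> ?rep (H #> x)"
      using rep[OF C] by simp
    then show ?thesis
      using C unfolding r_coset_def by blast
  qed
qed

lemma (in group) rcos_eq_iff_quotient:
  assumes H: "subgroup H G" and x: "x \<in> carrier G" and y: "y \<in> carrier G"
  shows "H #> x = H #> y \<longleftrightarrow> x \<otimes> inv y \<in> H"
proof
  assume "H #> x = H #> y"
  then have "x \<in> H #> y"
    using rcos_self[OF x H] by simp
  then show "x \<otimes> inv y \<in> H"
    using subgroup.rcos_module_imp[OF H is_group y] by simp
next
  assume "x \<otimes> inv y \<in> H"
  then have "x \<in> H #> y"
    using subgroup.rcos_module_rev[OF H is_group y x] by simp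
  then show "H #> x = H #> y"
    using repr_independence[OF _ y H] by simp
qed

text \<open>
  This form lets the index of one subgroup be bounded by the cosets of another, taken in a different
  group or of several images of an element at once, without comparing the subgroups themselves.
\<close>

lemma (in group) finite_indexI:
  assumes H: "subgroup H G"
    and fin: "finite (f ` carrier G)"
    and sep: "\<And>x y. \<lbrakk>x \<in> carrier G; y \<in> carrier G; f x = f y\<rbrakk> \<Longrightarrow> x \<otimes> inv y \<in> H"
  shows "finite_index H G"
proof -
  let ?coset = "\<lambda>v. H #> (SOME x. x \<in> carrier G \<and> f x = v)"
  have "H #> x = ?coset (f x)" if x: "x \<in> carrier G" for x
  proof -
    have "(SOME y. y \<in> carrier G \<and> f y = f x) \<in> carrier G
        \<and> f (SOME y. y \<in> carrier G \<and> f y = f x) = f x"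
      using x by (intro someI[of "\<lambda>y. y \<in> carrier G \<and> f y = f x"]) simp
    then show ?thesis
      using x sep rcos_eq_iff_quotient[OF H] by metis
  qed
  then have "rcosets H \<subseteq> ?coset ` f ` carrier G"
    unfolding RCOSETS_def by blast
  then show ?thesis
    unfolding finite_index_def using fin by (meson finite_imageI finite_subset)
qed

section \<open>The lambda action\<close>

sublocale skew_brace \<subseteq> circ: group B
  by (rule circle_group)

sublocale skew_brace \<subseteq> add: group "add_monoid B"
  rewrites "carrier (add_monoid B) = carrier B"
    and "monoid.mult (add_monoid B) = ring.add B"
    and "monoid.one (add_monoid B) = ring.zero B"
    and "m_inv (add_monoid B) = a_inv B"
  by (rule additive_group) (auto simp: a_inv_def)

context skew_brace
begin

abbreviation lam :: "'a \<Rightarrow> 'a \<Rightarrow> 'a"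
  where "lam \<equiv> lambda_map B"

lemma lam_closed [simp]:
  "\<lbrakk>a \<in> carrier B; b \<in> carrier B\<rbrakk> \<Longrightarrow> lam a b \<in> carrier B"
  by (simp add: lambda_map_def)

lemma circ_eq_add_lam:
  "\<lbrakk>a \<in> carrier B; b \<in> carrier B\<rbrakk> \<Longrightarrow> a \<otimes> b = a \<oplus> lam a b"
  by (simp add: lambda_map_def add.m_assoc[symmetric])

lemma lam_add:
  "\<lbrakk>a \<in> carrier B; b \<in> carrier B; c \<in> carrier B\<rbrakk> \<Longrightarrow> lam a (b \<oplus> c) = lam a b \<oplus> lam a c"
  by (simp add: lambda_map_def brace_distrib a_minus_def add.m_assoc)

lemma lam_zero: "a \<in> carrier B \<Longrightarrow> lam a \<zero> = \<zero>"
  using lam_add[of a \<zero> \<zero>] add.l_cancel_one[of "lam a \<zero>" "lam a \<zero>"] by simp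

lemma lam_neg:
  assumes "a \<in> carrier B" "b \<in> carrier B"
  shows "lam a (\<ominus> b) = \<ominus> lam a b"
proof -
  have "lam a (\<ominus> b) \<oplus> lam a b = \<zero>"
    using assms lam_add[of a "\<ominus> b" b] by (simp add: lam_zero)
  then show ?thesis
    using assms add.inv_equality[of "lam a (\<ominus> b)" "lam a b"] by simp
qed

text \<open>Compare \<open>a \<circ> (b \<circ> c)\<close> and \<open>(a \<circ> b) \<circ> c\<close>, both written as \<open>a \<circ> b\<close> plus a remainder.\<close>

lemma lam_circ:
  assumes a: "a \<in> carrier B" and b: "b \<in> carrier B" and c: "c \<in> carrier B"
  shows "lam (a \<otimes> b) c = lam a (lam b c)"
proof -
  have "(a \<otimes> b) \<oplus> lam (a \<otimes> b) c = a \<otimes> (b \<otimes> c)"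
    using a b c by (simp add: circ_eq_add_lam[symmetric] circ.m_assoc)
  also have "\<dots> = a \<otimes> (b \<oplus> lam b c)"
    using b c by (simp add: circ_eq_add_lam)
  also have "\<dots> = (a \<otimes> b) \<oplus> lam a (lam b c)"
    using a b c by (simp add: brace_distrib a_minus_def lambda_map_def add.m_assoc)
  finally show ?thesis
    using a b c by simp
qed

text \<open>The two groups share their neutral element because \<open>\<lambda>\<^sub>a\<close> fixes \<open>0\<close>, so \<open>a \<circ> 0 = a\<close>.\<close>

lemma one_eq_zero: "\<one> = \<zero>"
  using circ_eq_add_lam[of \<one> \<zero>] by (simp add: lam_zero)

lemma lam_one: "a \<in> carrier B \<Longrightarrow> lam \<one> a = a"
  by (metis add.l_one circ.l_one circ.one_closed circ_eq_add_lam lam_closed one_eq_zero)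

lemma lam_inv_cancel:
  assumes "a \<in> carrier B" "b \<in> carrier B"
  shows "lam a (lam (inv a) b) = b" and "lam (inv a) (lam a b) = b"
  using assms by (simp_all add: lam_circ[symmetric] lam_one)

text \<open>
  Closure under inverses uses \<open>a\<^sup>-\<^sup>1 = -\<lambda>\<^sub>b(a)\<close> with \<open>b = a\<^sup>-\<^sup>1\<close>, where \<open>\<lambda>\<^sub>b\<close> preserves \<open>A\<close> because it
  is inverse to \<open>\<lambda>\<^sub>a\<close>.
\<close>

lemma sub_skew_brace_circ_subgroup:
  assumes "sub_skew_brace A B"
  shows "subgroup A B"
proof -
  have A: "subgroup A (add_monoid B)" and inv: "\<And>a. a \<in> A \<Longrightarrow> lam a ` A = A"
    using assms by (auto simp: sub_skew_brace_def)
  note sub = subgroup.subset[OF A, simplified]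
  show ?thesis
  proof (rule circ.subgroupI)
    show "A \<subseteq> carrier B" by (rule sub)
    show "A \<noteq> {}" using subgroup.one_closed[OF A] by auto
    fix a assume a: "a \<in> A"
    then have ac: "a \<in> carrier B" using sub by auto
    show "inv a \<in> A"
    proof -
      obtain a' where a': "a' \<in> A" "a = lam a a'"
        using inv[OF a] a by blast
      then have "lam (inv a) a = a'"
        using lam_inv_cancel(2)[OF ac, of a'] sub by auto
      moreover have "inv a \<oplus> lam (inv a) a = \<zero>"
        using circ_eq_add_lam[of "inv a" a] ac by (simp add: one_eq_zero)
      ultimately have "inv a = \<ominus> a'"
        using ac a' sub by (metis add.inv_equality circ.inv_closed subsetD)
      then show ?thesis
        using subgroup.m_inv_closed[OF A a'(1)] by (simp add: a_inv_def)
    qed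
    fix b assume b: "b \<in> A"
    then have "a \<otimes> b = a \<oplus> lam a b"
      using circ_eq_add_lam sub ac by auto
    moreover have "lam a b \<in> A" using inv[OF a] b by blast
    ultimately show "a \<otimes> b \<in> A"
      using subgroup.m_closed[OF A a] by simp
  qed
qed

section \<open>Left ideals\<close>

lemma left_ideal_sub_skew_brace:
  "left_ideal L B \<Longrightarrow> sub_skew_brace L B"
  using subgroup.subset[of L "add_monoid B"] by (auto simp: left_ideal_def sub_skew_brace_def)

text \<open>
  The additive and multiplicative left cosets of a left ideal coincide.  Both finiteness
  conditions speak of right cosets, so the comparison goes through \<open>x \<mapsto> x\<^sup>-\<^sup>1\<close> on the multiplicative
  side, while normality turns left cosets into right cosets on the additive side.
\<close>

lemma strong_left_ideal_finite_index_circ: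
  assumes L: "strong_left_ideal L B" and fin: "finite_index L (add_monoid B)"
  shows "finite_index L B"
proof (rule circ.finite_indexI)
  have li: "left_ideal L B" and N: "L \<lhd> add_monoid B"
    using L by (auto simp: strong_left_ideal_def)
  have SL: "subgroup L (add_monoid B)" and inv: "\<And>b. b \<in> carrier B \<Longrightarrow> lam b ` L = L"
    using li by (auto simp: left_ideal_def)
  show "subgroup L B"
    using li by (intro sub_skew_brace_circ_subgroup left_ideal_sub_skew_brace)
  let ?f = "\<lambda>x. L #>\<^bsub>add_monoid B\<^esub> inv x"
  have "?f ` carrier B \<subseteq> rcosets\<^bsub>add_monoid B\<^esub> L"
    by (auto simp: RCOSETS_def)
  then show "finite (?f ` carrier B)"
    using fin unfolding finite_index_def by (rule finite_subset)
  fix x y assume x: "x \<in> carrier B" and y: "y \<in> carrier B" and eq: "?f x = ?f y"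
  have "inv y \<in> L #>\<^bsub>add_monoid B\<^esub> inv x"
    using add.rcos_self[of "inv y" L] SL y eq by simp
  then have "inv y \<in> inv x <#\<^bsub>add_monoid B\<^esub> L"
    using normal.coset_eq[OF N] x by simp
  then obtain l where l: "l \<in> L" "inv y = inv x \<oplus> l"
    by (auto simp: l_coset_def)
  obtain k where k: "k \<in> L" "l = lam (inv x) k"
    using inv[of "inv x"] l x by blast
  have kc: "k \<in> carrier B" using subgroup.subset[OF SL] k by auto
  have "inv y = inv x \<otimes> k"
    using circ_eq_add_lam[of "inv x" k] x kc l k by simp
  then have "x \<otimes> inv y = k"
    using x kc by (simp add: circ.m_assoc[symmetric])
  then show "x \<otimes> inv y \<in> L" using k by simp
qed

section \<open>The core of a sub skew brace\<close>

definition twist :: "'a \<Rightarrow> 'a \<Rightarrow> 'a \<Rightarrow> 'a"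
  where "twist b c x = c \<oplus> lam b x \<oplus> \<ominus> c"

definition core :: "'a set \<Rightarrow> 'a set"
  where "core A = {x \<in> carrier B. \<forall>b\<in>carrier B. \<forall>c\<in>carrier B. twist b c x \<in> A}"

lemma twist_closed [simp]:
  "\<lbrakk>b \<in> carrier B; c \<in> carrier B; x \<in> carrier B\<rbrakk> \<Longrightarrow> twist b c x \<in> carrier B"
  by (simp add: twist_def)

lemma twist_add:
  assumes "b \<in> carrier B" "c \<in> carrier B" "x \<in> carrier B" "y \<in> carrier B"
  shows "twist b c (x \<oplus> y) = twist b c x \<oplus> twist b c y"
proof -
  have "\<ominus> c \<oplus> (c \<oplus> z) = z" if "z \<in> carrier B" for z
    using that assms by (simp add: add.m_assoc[symmetric])
  then show ?thesis
    using assms by (simp add: twist_def lam_add add.m_assoc)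
qed

lemma twist_neg:
  assumes "b \<in> carrier B" "c \<in> carrier B" "x \<in> carrier B"
  shows "twist b c (\<ominus> x) = \<ominus> twist b c x"
  using assms by (simp add: twist_def lam_neg add.inv_mult_group add.m_assoc)

lemma twist_zero: "\<lbrakk>b \<in> carrier B; c \<in> carrier B\<rbrakk> \<Longrightarrow> twist b c \<zero> = \<zero>"
  by (simp add: twist_def lam_zero)

lemma twist_lam:
  "\<lbrakk>b \<in> carrier B; c \<in> carrier B; d \<in> carrier B; x \<in> carrier B\<rbrakk>
    \<Longrightarrow> twist b c (lam d x) = twist (b \<otimes> d) c x"
  by (simp add: twist_def lam_circ)

lemma twist_conjugate:
  "\<lbrakk>b \<in> carrier B; c \<in> carrier B; d \<in> carrier B; x \<in> carrier B\<rbrakk>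
    \<Longrightarrow> twist b c (d \<oplus> x \<oplus> \<ominus> d) = twist b (c \<oplus> lam b d) x"
  by (simp add: twist_def lam_add lam_neg add.inv_mult_group add.m_assoc)

lemma lam_twist:
  "\<lbrakk>a \<in> carrier B; b \<in> carrier B; c \<in> carrier B; x \<in> carrier B\<rbrakk>
    \<Longrightarrow> lam a (twist b c x) = twist (a \<otimes> b) (lam a c) x"
  by (simp add: twist_def lam_add lam_neg lam_circ)

lemma twist_translate:
  "\<lbrakk>a \<in> carrier B; b \<in> carrier B; c \<in> carrier B; x \<in> carrier B\<rbrakk>
    \<Longrightarrow> twist b (a \<oplus> c) x = a \<oplus> twist b c x \<oplus> \<ominus> a"
  by (simp add: twist_def add.inv_mult_group add.m_assoc)

lemma core_subset: "core A \<subseteq> A"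
proof
  fix x assume "x \<in> core A"
  then have "x \<in> carrier B" "twist \<one> \<zero> x \<in> A" by (auto simp: core_def)
  then show "x \<in> A" by (simp add: twist_def lam_one)
qed

lemma core_strong_left_ideal:
  assumes A: "subgroup A (add_monoid B)"
  shows "strong_left_ideal (core A) B"
proof -
  have sub: "subgroup (core A) (add_monoid B)"
  proof (rule add.subgroupI)
    show "core A \<subseteq> carrier B"
      by (auto simp: core_def)
    show "core A \<noteq> {}"
      using subgroup.one_closed[OF A] by (auto simp: core_def twist_zero intro!: exI[of _ \<zero>])
    show "\<ominus> x \<in> core A" if "x \<in> core A" for x
      using that subgroup.m_inv_closed[OF A] by (auto simp: core_def twist_neg a_inv_def[symmetric])
    show "x \<oplus> y \<in> core A" if "x \<in> core A" "y \<in> core A" for x y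
      using that subgroup.m_closed[OF A] by (auto simp: core_def twist_add)
  qed
  have closed: "lam d x \<in> core A" if "d \<in> carrier B" "x \<in> core A" for d x
    using that by (auto simp: core_def twist_lam)
  have "lam d ` core A = core A" if d: "d \<in> carrier B" for d
  proof
    show "lam d ` core A \<subseteq> core A" using closed d by auto
    show "core A \<subseteq> lam d ` core A"
    proof
      fix x assume x: "x \<in> core A"
      then have "x = lam d (lam (inv d) x)"
        using d by (simp add: core_def lam_inv_cancel)
      then show "x \<in> lam d ` core A"
        using closed[of "inv d" x] d x by blast
    qed
  qed
  then have li: "left_ideal (core A) B"
    using sub by (simp add: left_ideal_def)
  have "d \<oplus> x \<oplus> \<ominus> d \<in> core A" if "d \<in> carrier B" "x \<in> core A" for d x
    using that by (auto simp: core_def twist_conjugate)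
  then have "core A \<lhd> add_monoid B"
    using sub by (simp add: add.normal_inv_iff)
  then show ?thesis
    using li by (simp add: strong_left_ideal_def)
qed

text \<open>
  Write \<open>b = a \<circ> r\<close> and \<open>\<lambda>\<^sub>a\<^sup>-\<^sup>1(c) = a' + s\<close> with \<open>a, a' \<in> A\<close>.  Then the condition at \<open>(r, s)\<close> yields
  the one at \<open>(b, c)\<close> by conjugating with \<open>a'\<close> and applying \<open>\<lambda>\<^sub>a\<close>, both of which preserve \<open>A\<close>.
\<close>

lemma core_iff_representatives:
  assumes A: "sub_skew_brace A B"
    and R: "R \<subseteq> carrier B" "\<And>b. b \<in> carrier B \<Longrightarrow> \<exists>a\<in>A. \<exists>r\<in>R. b = a \<otimes> r"
    and S: "S \<subseteq> carrier B" "\<And>c. c \<in> carrier B \<Longrightarrow> \<exists>a\<in>A. \<exists>s\<in>S. c = a \<oplus> s"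
    and x: "x \<in> carrier B"
  shows "x \<in> core A \<longleftrightarrow> (\<forall>r\<in>R. \<forall>s\<in>S. twist r s x \<in> A)"
proof
  assume "x \<in> core A"
  then show "\<forall>r\<in>R. \<forall>s\<in>S. twist r s x \<in> A"
    using R(1) S(1) by (auto simp: core_def)
next
  assume hyp: "\<forall>r\<in>R. \<forall>s\<in>S. twist r s x \<in> A"
  have SA: "subgroup A (add_monoid B)" and inv: "\<And>a. a \<in> A \<Longrightarrow> lam a ` A = A"
    using A by (auto simp: sub_skew_brace_def)
  note sub = subgroup.subset[OF SA, simplified]
  have "twist b c x \<in> A" if b: "b \<in> carrier B" and c: "c \<in> carrier B" for b c
  proof -
    obtain a r where a: "a \<in> A" "r \<in> R" "b = a \<otimes> r"
      using R(2)[OF b] by blast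
    then have ac: "a \<in> carrier B" "r \<in> carrier B" using sub R(1) by auto
    obtain a' s where a': "a' \<in> A" "s \<in> S" "lam (inv a) c = a' \<oplus> s"
      using S(2)[of "lam (inv a) c"] ac c by auto
    then have a'c: "a' \<in> carrier B" "s \<in> carrier B" using sub S(1) by auto
    have "twist r (lam (inv a) c) x = a' \<oplus> twist r s x \<oplus> \<ominus> a'"
      using a' a'c ac x by (simp add: twist_translate)
    also have "\<dots> \<in> A"
      using hyp a a' subgroup.m_closed[OF SA] subgroup.m_inv_closed[OF SA]
      by (simp add: a_inv_def)
    finally have "lam a (twist r (lam (inv a) c) x) \<in> A"
      using inv[OF a(1)] by blast
    then show ?thesis
      using ac a c x by (simp add: lam_twist lam_inv_cancel)
  qed
  then show "x \<in> core A"
    using x by (simp add: core_def)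
qed

text \<open>
  An element of \<open>B\<close> is located modulo the core by the finitely many \<open>A\<close>-cosets of its images under
  the representative twists.
\<close>

lemma core_finite_index:
  assumes A: "sub_skew_brace A B"
    and fin_add: "finite_index A (add_monoid B)" and fin_circ: "finite_index A B"
  shows "finite_index (core A) (add_monoid B)"
proof -
  have SA: "subgroup A (add_monoid B)"
    using A by (simp add: sub_skew_brace_def)
  obtain R where R: "finite R" "R \<subseteq> carrier B" "\<And>b. b \<in> carrier B \<Longrightarrow> \<exists>a\<in>A. \<exists>r\<in>R. b = a \<otimes> r"
    using circ.finite_index_representatives[OF sub_skew_brace_circ_subgroup[OF A] fin_circ] by blast
  obtain S where S: "finite S" "S \<subseteq> carrier B" "\<And>c. c \<in> carrier B \<Longrightarrow> \<exists>a\<in>A. \<exists>s\<in>S. c = a \<oplus> s"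
    using add.finite_index_representatives[OF SA fin_add] by blast
  define f where "f x = (\<lambda>(r, s)\<in>R \<times> S. A #>\<^bsub>add_monoid B\<^esub> twist r s x)" for x
  show ?thesis
  proof (rule add.finite_indexI)
    show "subgroup (core A) (add_monoid B)"
      using core_strong_left_ideal[OF SA] by (simp add: strong_left_ideal_def left_ideal_def)
    have "A #>\<^bsub>add_monoid B\<^esub> twist r s x \<in> rcosets\<^bsub>add_monoid B\<^esub> A"
      if "x \<in> carrier B" "r \<in> R" "s \<in> S" for x r s
      using that R(2) S(2) subgroup.subset[OF SA] by (intro add.rcosetsI) (auto simp: subset_iff)
    then have "f ` carrier B \<subseteq> R \<times> S \<rightarrow>\<^sub>E rcosets\<^bsub>add_monoid B\<^esub> A"
      unfolding f_def by (intro image_subsetI restrict_PiE_iff[THEN iffD2]) auto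
    moreover have "finite (R \<times> S \<rightarrow>\<^sub>E rcosets\<^bsub>add_monoid B\<^esub> A)"
      using R(1) S(1) fin_add by (intro finite_PiE) (auto simp: finite_index_def)
    ultimately show "finite (f ` carrier B)"
      by (rule finite_subset)
    fix x y assume x: "x \<in> carrier B" and y: "y \<in> carrier B" and eq: "f x = f y"
    have "twist r s (x \<oplus> \<ominus> y) \<in> A" if r: "r \<in> R" and s: "s \<in> S" for r s
    proof -
      have rs: "r \<in> carrier B" "s \<in> carrier B" using r s R(2) S(2) by auto
      have "A #>\<^bsub>add_monoid B\<^esub> twist r s x = A #>\<^bsub>add_monoid B\<^esub> twist r s y"
        using fun_cong[OF eq, of "(r, s)"] r s by (simp add: f_def)
      then have "twist r s x \<oplus> \<ominus> twist r s y \<in> A"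
        using add.rcos_eq_iff_quotient[OF SA] rs x y by simp
      then show ?thesis
        using rs x y by (simp add: twist_add twist_neg)
    qed
    then show "x \<oplus> \<ominus> y \<in> core A"
      using core_iff_representatives[OF A R(2,3) S(2,3)] x y by simp
  qed
qed

end

theorem proposition3p2:
  fixes B :: "('a, 'm) ring_scheme" and A :: "'a set"
  assumes "skew_brace B"
    and "sub_skew_brace A B"
    and "finite_index A (add_monoid B)"
    and "finite_index A B"
  shows "\<exists>L. strong_left_ideal L B \<and> finite_index L (add_monoid B) \<and> finite_index L B \<and> L \<subseteq> A"
proof -
  interpret skew_brace B by (rule assms(1))
  have "strong_left_ideal (core A) B"
    using assms(2) by (intro core_strong_left_ideal) (simp add: sub_skew_brace_def)
  moreover have "finite_index (core A) (add_monoid B)"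
    using assms(2-4) by (rule core_finite_index)
  ultimately show ?thesis
    using strong_left_ideal_finite_index_circ core_subset by blast
qed

end
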